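(* For all positive integers $m,n,p,q$ one has $X_{m,n}\times\mathbb{A}^1\cong X_{p,q}\times\mathbb{A}^1$ as algebraic varieties. Likewise, for all positive integers $m,n,p,q$ and all integers $0\le k,l\le 4$ one has $E_{m,n,k}\times\mathbb{A}^1\cong E_{p,q,l}\times\mathbb{A}^1$ as algebraic varieties.
   Context: All varieties are over $\mathbb{C}$. For positive integers $m,n$, $X_{m,n}$ is the hypersurface in $\mathbb{A}^4=\mathrm{Spec}(\mathbb{C}[x,y,u,v])$ defined by $x^m v-y^n u=1$. Let $S\subset\mathbb{A}^3$ be the surface $x^2+y^3+z^5=0$ and $U=S\setminus\{0\}$ its smooth locus. For positive integers $m,n$ and $0\le k\le 4$, let $Z_{m,n,k}\subset\mathbb{A}^5$ (coordinates $x,y,z,u,v$) be the threefold defined by $x^m v-y^n u-z^k=0$ and $x^2+y^3+z^5=0$, let $\pi_{m,n,k}:Z_{m,n,k}\to S$ be the projection $(x,y,z,u,v)\mapsto(x,y,z)$, and set $E_{m,n,k}=\pi_{m,n,k}^{-1}(U)$. It is the total space of the principal $\mathbb{G}_a$-bundle over $U$ given by the Čech cocycle $x^{-m}y^{-n}z^k$ relative to the cover of $U$ by $\{x\ne0\}$ and $\{y\neq 0\}$. *)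

theory Defs
  imports "HOL-Analysis.Analysis"
begin

text \<open>
  Affine \<open>n\<close>-space over the complex numbers is \<^typ>\<open>complex ^ 'n\<close>, carrying the Zariski topology
  \<open>zariski\<close> below and never the Euclidean topology of the type class. Varieties are quasi-affine
  and are identified with their sets of closed points. This loses nothing for the varieties
  considered here: they are smooth, hence reduced.
\<close>

inductive polynomial_fun :: "(complex ^ 'n \<Rightarrow> complex) \<Rightarrow> bool" where
  const: "polynomial_fun (\<lambda>x. c)"
| coord: "polynomial_fun (\<lambda>x. x $ i)"
| add: "polynomial_fun f \<Longrightarrow> polynomial_fun g \<Longrightarrow> polynomial_fun (\<lambda>x. f x + g x)"
| mult: "polynomial_fun f \<Longrightarrow> polynomial_fun g \<Longrightarrow> polynomial_fun (\<lambda>x. f x * g x)"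

definition zariski_open :: "(complex ^ 'n) set \<Rightarrow> bool" where
  "zariski_open U \<longleftrightarrow>
     (\<exists>F. (\<forall>f\<in>F. polynomial_fun f) \<and> - U = {x. \<forall>f\<in>F. f x = 0})"

definition zariski :: "(complex ^ 'n) topology" where
  "zariski = topology zariski_open"

lemma zariski_open_iff:
  "zariski_open U \<longleftrightarrow>
     (\<forall>x\<in>U. \<exists>f. polynomial_fun f \<and> f x \<noteq> 0 \<and> (\<forall>y. y \<notin> U \<longrightarrow> f y = 0))"
    (is "_ \<longleftrightarrow> ?R")
proof
  assume "zariski_open U"
  then obtain F where F: "\<forall>f\<in>F. polynomial_fun f" and U: "- U = {x. \<forall>f\<in>F. f x = 0}"
    unfolding zariski_open_def by (elim exE conjE) (rule that)
  show ?R
  proof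
    fix x assume "x \<in> U"
    then have "\<not> (\<forall>f\<in>F. f x = 0)"
      unfolding mem_Collect_eq[of x "\<lambda>x. \<forall>f\<in>F. f x = 0", symmetric] U[symmetric]
      by simp
    then obtain f where f: "f \<in> F" "f x \<noteq> 0"
      by blast
    have "f y = 0" if "y \<notin> U" for y
    proof -
      have "y \<in> {x. \<forall>f\<in>F. f x = 0}"
        unfolding U[symmetric] using that by simp
      then have "\<forall>f\<in>F. f y = 0"
        by (rule CollectD)
      then show ?thesis
        using f(1) by (rule bspec)
    qed
    moreover have "polynomial_fun f"
      using F f(1) by (rule bspec)
    ultimately show "\<exists>f. polynomial_fun f \<and> f x \<noteq> 0 \<and> (\<forall>y. y \<notin> U \<longrightarrow> f y = 0)"
      using f(2) by blast
  qed
next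
  assume R: ?R
  define F where "F = {f. polynomial_fun f \<and> (\<forall>y. y \<notin> U \<longrightarrow> f y = 0)}"
  have "- U = {x. \<forall>f\<in>F. f x = 0}"
  proof (intro equalityI subsetI CollectI ballI)
    fix x f assume "x \<in> - U" "f \<in> F"
    then show "f x = 0" unfolding F_def by blast
  next
    fix x assume x: "x \<in> {x. \<forall>f\<in>F. f x = 0}"
    show "x \<in> - U"
    proof (rule ComplI)
      assume "x \<in> U"
      with R obtain f where f: "polynomial_fun f" "f x \<noteq> 0" "\<forall>y. y \<notin> U \<longrightarrow> f y = 0"
        by blast
      then have "f \<in> F" unfolding F_def by blast
      from x have "\<forall>f\<in>F. f x = 0" by (rule CollectD)
      then have "f x = 0" using \<open>f \<in> F\<close> by (rule bspec)
      with f(2) show False by (rule notE)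
    qed
  qed
  moreover have "\<forall>f\<in>F. polynomial_fun f"
    unfolding F_def by blast
  ultimately show "zariski_open U"
    unfolding zariski_open_def by (intro exI[of _ F] conjI)
qed

lemma istopology_zariski_open: "istopology zariski_open"
  unfolding istopology_def
proof (intro conjI allI impI)
  fix S T :: "(complex ^ 'n) set"
  assume S: "zariski_open S" and T: "zariski_open T"
  show "zariski_open (S \<inter> T)"
    unfolding zariski_open_iff
  proof
    fix x assume "x \<in> S \<inter> T"
    then have "x \<in> S" "x \<in> T" by simp_all
    obtain f where f: "polynomial_fun f" "f x \<noteq> 0" "\<And>y. y \<notin> S \<Longrightarrow> f y = 0"
      using S[unfolded zariski_open_iff, THEN bspec, OF \<open>x \<in> S\<close>] by blast
    obtain g where g: "polynomial_fun g" "g x \<noteq> 0" "\<And>y. y \<notin> T \<Longrightarrow> g y = 0"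
      using T[unfolded zariski_open_iff, THEN bspec, OF \<open>x \<in> T\<close>] by blast
    show "\<exists>h. polynomial_fun h \<and> h x \<noteq> 0 \<and> (\<forall>y. y \<notin> S \<inter> T \<longrightarrow> h y = 0)"
    proof (intro exI conjI)
      show "polynomial_fun (\<lambda>y. f y * g y)"
        using f(1) g(1) by (rule polynomial_fun.mult)
      show "f x * g x \<noteq> 0"
        using f(2) g(2) by (rule no_zero_divisors)
      show "\<forall>y. y \<notin> S \<inter> T \<longrightarrow> f y * g y = 0"
        using f(3) g(3) by (metis IntI mult_eq_0_iff)
    qed
  qed
next
  fix K :: "(complex ^ 'n) set set"
  assume K: "\<forall>S\<in>K. zariski_open S"
  show "zariski_open (\<Union>K)"
    unfolding zariski_open_iff
  proof
    fix x assume "x \<in> \<Union>K"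
    then obtain S where "S \<in> K" "x \<in> S" by (rule UnionE)
    obtain f where "polynomial_fun f" "f x \<noteq> 0" "\<And>y. y \<notin> S \<Longrightarrow> f y = 0"
      using K[THEN bspec, OF \<open>S \<in> K\<close>, unfolded zariski_open_iff, THEN bspec, OF \<open>x \<in> S\<close>]
      by blast
    with \<open>S \<in> K\<close> show "\<exists>f. polynomial_fun f \<and> f x \<noteq> 0 \<and> (\<forall>y. y \<notin> \<Union>K \<longrightarrow> f y = 0)"
      by blast
  qed
qed

lemma openin_zariski: "openin zariski = zariski_open"
  unfolding zariski_def by (rule topology_inverse'[OF istopology_zariski_open])

definition regular_on :: "(complex ^ 'n) set \<Rightarrow> (complex ^ 'n \<Rightarrow> complex) \<Rightarrow> bool" where
  "regular_on V f \<longleftrightarrow>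
     (\<forall>a\<in>V. \<exists>U g h. openin (subtopology zariski V) U \<and> a \<in> U
        \<and> polynomial_fun g \<and> polynomial_fun h
        \<and> (\<forall>x\<in>U. h x \<noteq> 0 \<and> f x = g x / h x))"

definition morphism ::
  "(complex ^ 'n) set \<Rightarrow> (complex ^ 'm) set \<Rightarrow> (complex ^ 'n \<Rightarrow> complex ^ 'm) \<Rightarrow> bool" where
  "morphism V W \<phi> \<longleftrightarrow>
     continuous_map (subtopology zariski V) (subtopology zariski W) \<phi>
     \<and> (\<forall>O' f. openin (subtopology zariski W) O' \<and> regular_on O' f
          \<longrightarrow> regular_on {x \<in> V. \<phi> x \<in> O'} (f \<circ> \<phi>))"

definition isomorphic :: "(complex ^ 'n) set \<Rightarrow> (complex ^ 'm) set \<Rightarrow> bool"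
    (infix "\<cong>\<^sub>v" 50) where
  "V \<cong>\<^sub>v W \<longleftrightarrow>
     (\<exists>\<phi> \<psi>. morphism V W \<phi> \<and> morphism W V \<psi>
        \<and> (\<forall>x\<in>V. \<psi> (\<phi> x) = x) \<and> (\<forall>y\<in>W. \<phi> (\<psi> y) = y))"

text \<open>
  The product lives in the affine space whose coordinates are the disjoint union of the
  coordinates of the factors.
\<close>

definition product_variety ::
  "(complex ^ 'n) set \<Rightarrow> (complex ^ 'm) set \<Rightarrow> (complex ^ ('n + 'm)) set"
    (infixr "\<times>\<^sub>v" 80) where
  "V \<times>\<^sub>v W = {p. (\<chi> i. p $ Inl i) \<in> V \<and> (\<chi> j. p $ Inr j) \<in> W}"

definition affine_line :: "(complex ^ 1) set" where
  "affine_line = UNIV"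

text \<open>
  Coordinates are indexed from 1, in the orders \<open>(x, y, u, v)\<close> on 4-space, \<open>(x, y, z)\<close> on
  3-space and \<open>(x, y, z, u, v)\<close> on 5-space. In the index types \<^typ>\<open>4\<close>, \<^typ>\<open>3\<close> and \<^typ>\<open>5\<close>
  the numerals \<open>4\<close>, \<open>3\<close> and \<open>5\<close> denote \<open>0\<close>, so the indices used are pairwise distinct and
  exhaust the type.
\<close>

definition hypersurface_X :: "nat \<Rightarrow> nat \<Rightarrow> (complex ^ 4) set" where
  "hypersurface_X m n =
     {p. let x = p $ 1; y = p $ 2; u = p $ 3; v = p $ 4 in x ^ m * v - y ^ n * u = 1}"

definition surface_S :: "(complex ^ 3) set" where
  "surface_S = {p. let x = p $ 1; y = p $ 2; z = p $ 3 in x ^ 2 + y ^ 3 + z ^ 5 = 0}"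

definition punctured_U :: "(complex ^ 3) set" where
  "punctured_U = surface_S - {0}"

definition threefold_Z :: "nat \<Rightarrow> nat \<Rightarrow> nat \<Rightarrow> (complex ^ 5) set" where
  "threefold_Z m n k =
     {p. let x = p $ 1; y = p $ 2; z = p $ 3; u = p $ 4; v = p $ 5 in
          x ^ m * v - y ^ n * u - z ^ k = 0 \<and> x ^ 2 + y ^ 3 + z ^ 5 = 0}"

definition base_proj :: "complex ^ 5 \<Rightarrow> complex ^ 3" where
  "base_proj p = vector [p $ 1, p $ 2, p $ 3]"

definition bundle_E :: "nat \<Rightarrow> nat \<Rightarrow> nat \<Rightarrow> (complex ^ 5) set" where
  "bundle_E m n k = {p \<in> threefold_Z m n k. base_proj p \<in> punctured_U}"

end

theory Submission
  imports Defs
begin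

text \<open>
  Both families consist of additive torsors over a fixed base: \<open>X\<^sub>m\<^sub>,\<^sub>n\<close> over the punctured plane, and
  \<open>E\<^sub>m\<^sub>,\<^sub>n\<^sub>,\<^sub>k\<close> over the punctured surface \<open>U\<close>. The proof is the fibre product argument of
  Danielewski. If \<open>P\<close> and \<open>Q\<close> are two such torsors, then \<open>P \<times> Q\<close> over the base is an additive torsor
  over \<open>P\<close> and over \<open>Q\<close>; if both of these are trivial, the fibre product is isomorphic to
  \<open>P \<times> \<A>\<^sup>1\<close> and to \<open>Q \<times> \<A>\<^sup>1\<close> (\<open>additive_torsor_times_line_isomorphic\<close>). Additive torsors
  over affine varieties are trivial, so all that matters is that the total spaces are affine.

  Affineness is used in the concrete form that \<open>x\<close> and \<open>y\<close> generate the unit ideal in the ring of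
  global regular functions. Then so do \<open>x\<^sup>p\<close> and \<open>y\<^sup>q\<close> (\<open>unit_ideal_powers\<close>), and from
  \<open>1 = \<alpha> x\<^sup>p + \<beta> y\<^sup>q\<close> a section of the pulled back torsor \<open>x\<^sup>p v - y\<^sup>q u = c\<close> can be read off. For
  \<open>X\<^sub>m\<^sub>,\<^sub>n\<close> the equation \<open>x\<^sup>m v - y\<^sup>n u = 1\<close> itself is a representation of \<open>1\<close>. For \<open>E\<^sub>m\<^sub>,\<^sub>n\<^sub>,\<^sub>k\<close> the
  coordinate functions do not suffice when \<open>k > 0\<close>, because the fibre of \<open>Z\<^sub>m\<^sub>,\<^sub>n\<^sub>,\<^sub>k\<close> over the
  singular point is not empty. Multiplying the defining equation by \<open>z\<^sup>4\<^sup>-\<^sup>k\<close> gives regular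
  functions with \<open>x v' - y u' = z\<^sup>4\<close>, so one torsor, the quotient of \<open>SL\<^sub>2\<close> by the
  binary icosahedral group, decides all cases. The lemma \<open>icosahedral_unit_ideal\<close> constructs further
  regular functions on it, coefficients of Klein's form of degree 12, whose quadratic relations
  force \<open>1\<close> into the ideal of \<open>x\<close> and \<open>y\<close>.
\<close>

section \<open>Regular functions and morphisms\<close>

lemma openin_subtopology_zariski_iff:
  "openin (subtopology zariski V) U \<longleftrightarrow>
     U \<subseteq> V \<and> (\<forall>a\<in>U. \<exists>h. polynomial_fun h \<and> h a \<noteq> 0 \<and> (\<forall>x\<in>V. h x \<noteq> 0 \<longrightarrow> x \<in> U))"
  (is "?L \<longleftrightarrow> ?R")
proof
  assume ?L
  then obtain T where T: "zariski_open T" and U: "U = T \<inter> V"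
    unfolding openin_subtopology openin_zariski by blast
  show ?R
  proof (intro conjI ballI)
    show "U \<subseteq> V" using U by blast
    fix a assume "a \<in> U"
    then obtain h where "polynomial_fun h" "h a \<noteq> 0" "\<forall>y. y \<notin> T \<longrightarrow> h y = 0"
      using T U unfolding zariski_open_iff by blast
    then show "\<exists>h. polynomial_fun h \<and> h a \<noteq> 0 \<and> (\<forall>x\<in>V. h x \<noteq> 0 \<longrightarrow> x \<in> U)"
      using U by blast
  qed
next
  assume R: ?R
  define T where "T = {x. \<exists>h. polynomial_fun h \<and> h x \<noteq> 0 \<and> (\<forall>y\<in>V. h y \<noteq> 0 \<longrightarrow> y \<in> U)}"
  have "zariski_open T"
    unfolding zariski_open_iff T_def by blast
  moreover have "U = T \<inter> V"
    using R unfolding T_def by blast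
  ultimately show ?L
    unfolding openin_subtopology openin_zariski by blast
qed

text \<open>
  Multiplying numerator and denominator by a polynomial that cuts out the open set makes the
  denominator alone record where the fraction is valid.
\<close>

lemma regular_on_iff:
  "regular_on V f \<longleftrightarrow>
     (\<forall>a\<in>V. \<exists>g h. polynomial_fun g \<and> polynomial_fun h \<and> h a \<noteq> 0
        \<and> (\<forall>x\<in>V. h x \<noteq> 0 \<longrightarrow> f x = g x / h x))"
  (is "?L \<longleftrightarrow> ?R")
proof
  assume L: ?L
  show ?R
  proof
    fix a assume "a \<in> V"
    then obtain U g h where U: "openin (subtopology zariski V) U" "a \<in> U"
      and gh: "polynomial_fun g" "polynomial_fun h" "\<forall>x\<in>U. h x \<noteq> 0 \<and> f x = g x / h x"
      using L unfolding regular_on_def by blast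
    obtain k where k: "polynomial_fun k" "k a \<noteq> 0" "\<forall>x\<in>V. k x \<noteq> 0 \<longrightarrow> x \<in> U"
      using U unfolding openin_subtopology_zariski_iff by blast
    show "\<exists>g h. polynomial_fun g \<and> polynomial_fun h \<and> h a \<noteq> 0
        \<and> (\<forall>x\<in>V. h x \<noteq> 0 \<longrightarrow> f x = g x / h x)"
    proof (intro exI conjI)
      show "polynomial_fun (\<lambda>x. g x * k x)" "polynomial_fun (\<lambda>x. h x * k x)"
        using gh k by (auto intro: polynomial_fun.mult)
      show "h a * k a \<noteq> 0"
        using gh(3) U(2) k(2) by simp
      show "\<forall>x\<in>V. h x * k x \<noteq> 0 \<longrightarrow> f x = (g x * k x) / (h x * k x)"
        using gh(3) k(3) by auto
    qed
  qed
next
  assume R: ?R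
  show ?L
    unfolding regular_on_def
  proof
    fix a assume "a \<in> V"
    then obtain g h where gh: "polynomial_fun g" "polynomial_fun h" "h a \<noteq> 0"
      "\<forall>x\<in>V. h x \<noteq> 0 \<longrightarrow> f x = g x / h x"
      using R by blast
    have "openin (subtopology zariski V) {x \<in> V. h x \<noteq> 0}"
      unfolding openin_subtopology_zariski_iff using gh(2) by blast
    then show "\<exists>U g h. openin (subtopology zariski V) U \<and> a \<in> U
        \<and> polynomial_fun g \<and> polynomial_fun h \<and> (\<forall>x\<in>U. h x \<noteq> 0 \<and> f x = g x / h x)"
      using gh \<open>a \<in> V\<close> by (intro exI[of _ "{x \<in> V. h x \<noteq> 0}"] exI[of _ g] exI[of _ h]) auto
  qed
qed

named_theorems regular

lemma regular_on_polynomial: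
  assumes "polynomial_fun f"
  shows "regular_on V f"
  unfolding regular_on_iff
  using assms polynomial_fun.const[of 1] by (metis div_by_1 zero_neq_one)

lemma regular_on_const [regular]: "regular_on V (\<lambda>x. c)"
  by (intro regular_on_polynomial polynomial_fun.const)

lemma regular_on_coord [regular]: "regular_on V (\<lambda>x. x $ i)"
  by (intro regular_on_polynomial polynomial_fun.coord)

lemma regular_on_subset:
  assumes "regular_on V f" "W \<subseteq> V"
  shows "regular_on W f"
  unfolding regular_on_iff
proof
  fix a assume "a \<in> W"
  then obtain g h where "polynomial_fun g" "polynomial_fun h" "h a \<noteq> 0"
    "\<forall>x\<in>V. h x \<noteq> 0 \<longrightarrow> f x = g x / h x"
    using assms unfolding regular_on_iff by blast
  then show "\<exists>g h. polynomial_fun g \<and> polynomial_fun h \<and> h a \<noteq> 0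
      \<and> (\<forall>x\<in>W. h x \<noteq> 0 \<longrightarrow> f x = g x / h x)"
    using assms(2) by blast
qed

lemma regular_on_add [regular]:
  assumes "regular_on V f" "regular_on V g"
  shows "regular_on V (\<lambda>x. f x + g x)"
  unfolding regular_on_iff
proof
  fix a assume a: "a \<in> V"
  obtain f1 f2 where f: "polynomial_fun f1" "polynomial_fun f2" "f2 a \<noteq> 0"
    "\<forall>x\<in>V. f2 x \<noteq> 0 \<longrightarrow> f x = f1 x / f2 x"
    using assms(1) a unfolding regular_on_iff by blast
  obtain g1 g2 where g: "polynomial_fun g1" "polynomial_fun g2" "g2 a \<noteq> 0"
    "\<forall>x\<in>V. g2 x \<noteq> 0 \<longrightarrow> g x = g1 x / g2 x"
    using assms(2) a unfolding regular_on_iff by blast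
  show "\<exists>r s. polynomial_fun r \<and> polynomial_fun s \<and> s a \<noteq> 0
      \<and> (\<forall>x\<in>V. s x \<noteq> 0 \<longrightarrow> f x + g x = r x / s x)"
  proof (intro exI conjI)
    show "polynomial_fun (\<lambda>x. f1 x * g2 x + g1 x * f2 x)" "polynomial_fun (\<lambda>x. f2 x * g2 x)"
      using f g by (auto intro: polynomial_fun.intros)
    show "f2 a * g2 a \<noteq> 0"
      using f g by simp
    show "\<forall>x\<in>V. f2 x * g2 x \<noteq> 0 \<longrightarrow>
        f x + g x = (f1 x * g2 x + g1 x * f2 x) / (f2 x * g2 x)"
      using f(4) g(4) by (auto simp: field_simps)
  qed
qed

lemma regular_on_mult [regular]:
  assumes "regular_on V f" "regular_on V g"
  shows "regular_on V (\<lambda>x. f x * g x)"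
  unfolding regular_on_iff
proof
  fix a assume a: "a \<in> V"
  obtain f1 f2 where f: "polynomial_fun f1" "polynomial_fun f2" "f2 a \<noteq> 0"
    "\<forall>x\<in>V. f2 x \<noteq> 0 \<longrightarrow> f x = f1 x / f2 x"
    using assms(1) a unfolding regular_on_iff by blast
  obtain g1 g2 where g: "polynomial_fun g1" "polynomial_fun g2" "g2 a \<noteq> 0"
    "\<forall>x\<in>V. g2 x \<noteq> 0 \<longrightarrow> g x = g1 x / g2 x"
    using assms(2) a unfolding regular_on_iff by blast
  show "\<exists>r s. polynomial_fun r \<and> polynomial_fun s \<and> s a \<noteq> 0
      \<and> (\<forall>x\<in>V. s x \<noteq> 0 \<longrightarrow> f x * g x = r x / s x)"
  proof (intro exI conjI)
    show "polynomial_fun (\<lambda>x. f1 x * g1 x)" "polynomial_fun (\<lambda>x. f2 x * g2 x)"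
      using f g by (auto intro: polynomial_fun.intros)
    show "f2 a * g2 a \<noteq> 0"
      using f g by simp
    show "\<forall>x\<in>V. f2 x * g2 x \<noteq> 0 \<longrightarrow> f x * g x = (f1 x * g1 x) / (f2 x * g2 x)"
      using f(4) g(4) by auto
  qed
qed

lemma regular_on_minus [regular]:
  assumes "regular_on V f"
  shows "regular_on V (\<lambda>x. - f x)"
  using regular_on_mult[OF regular_on_const[of V "-1"] assms] by simp

lemma regular_on_diff [regular]:
  assumes "regular_on V f" "regular_on V g"
  shows "regular_on V (\<lambda>x. f x - g x)"
  using regular_on_add[OF assms(1) regular_on_minus[OF assms(2)]] by simp

lemma regular_on_power [regular]:
  assumes "regular_on V f"
  shows "regular_on V (\<lambda>x. f x ^ n)"
  by (induction n) (auto intro: regular assms)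

text \<open>
  Regularity is local, so quotients of regular functions may take the place of quotients of
  polynomials in its definition.
\<close>

lemma regular_on_local_quotient:
  assumes "\<And>a. a \<in> V \<Longrightarrow> \<exists>g h. regular_on V g \<and> regular_on V h \<and> h a \<noteq> 0
      \<and> (\<forall>x\<in>V. h x \<noteq> 0 \<longrightarrow> f x = g x / h x)"
  shows "regular_on V f"
  unfolding regular_on_iff
proof
  fix a assume a: "a \<in> V"
  obtain g h where gh: "regular_on V g" "regular_on V h" "h a \<noteq> 0"
    "\<forall>x\<in>V. h x \<noteq> 0 \<longrightarrow> f x = g x / h x"
    using assms[OF a] by blast
  obtain g1 g2 where g: "polynomial_fun g1" "polynomial_fun g2" "g2 a \<noteq> 0"
    "\<forall>x\<in>V. g2 x \<noteq> 0 \<longrightarrow> g x = g1 x / g2 x"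
    using gh(1) a unfolding regular_on_iff by blast
  obtain h1 h2 where h: "polynomial_fun h1" "polynomial_fun h2" "h2 a \<noteq> 0"
    "\<forall>x\<in>V. h2 x \<noteq> 0 \<longrightarrow> h x = h1 x / h2 x"
    using gh(2) a unfolding regular_on_iff by blast
  show "\<exists>r s. polynomial_fun r \<and> polynomial_fun s \<and> s a \<noteq> 0
      \<and> (\<forall>x\<in>V. s x \<noteq> 0 \<longrightarrow> f x = r x / s x)"
  proof (intro exI conjI)
    show "polynomial_fun (\<lambda>x. g1 x * (h2 x * h2 x))" "polynomial_fun (\<lambda>x. g2 x * (h1 x * h2 x))"
      using g h by (auto intro: polynomial_fun.intros)
    have "h1 a \<noteq> 0"
      using h(3,4) gh(3) a by auto
    then show "g2 a * (h1 a * h2 a) \<noteq> 0"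
      using g(3) h(3) by simp
    show "\<forall>x\<in>V. g2 x * (h1 x * h2 x) \<noteq> 0 \<longrightarrow>
        f x = (g1 x * (h2 x * h2 x)) / (g2 x * (h1 x * h2 x))"
      using g(4) h(4) gh(4) by auto
  qed
qed

lemma regular_on_polynomial_compose:
  assumes "\<And>i. regular_on V (\<lambda>x. \<phi> x $ i)" and "polynomial_fun f"
  shows "regular_on V (\<lambda>x. f (\<phi> x))"
  using assms(2) by induction (auto intro: regular assms(1))

lemma regular_on_compose:
  assumes \<phi>: "\<And>i. regular_on V (\<lambda>x. \<phi> x $ i)" "\<And>x. x \<in> V \<Longrightarrow> \<phi> x \<in> W"
    and f: "regular_on W f"
  shows "regular_on V (\<lambda>x. f (\<phi> x))"
proof (rule regular_on_local_quotient)
  fix a assume a: "a \<in> V"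
  then obtain g h where "polynomial_fun g" "polynomial_fun h" "h (\<phi> a) \<noteq> 0"
    "\<forall>y\<in>W. h y \<noteq> 0 \<longrightarrow> f y = g y / h y"
    using f \<phi>(2) unfolding regular_on_iff by blast
  then show "\<exists>g h. regular_on V g \<and> regular_on V h \<and> h a \<noteq> 0
      \<and> (\<forall>x\<in>V. h x \<noteq> 0 \<longrightarrow> f (\<phi> x) = g x / h x)"
    using \<phi> regular_on_polynomial_compose[OF \<phi>(1)]
    by (intro exI[of _ "\<lambda>x. g (\<phi> x)"] exI[of _ "\<lambda>x. h (\<phi> x)"]) auto
qed

lemma morphismI:
  assumes \<phi>: "\<And>i. regular_on V (\<lambda>x. \<phi> x $ i)" "\<And>x. x \<in> V \<Longrightarrow> \<phi> x \<in> W"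
  shows "morphism V W \<phi>"
  unfolding morphism_def
proof (intro conjI allI impI)
  have top: "topspace (subtopology zariski V) = V" for V :: "(complex ^ 'k) set"
  proof -
    have "openin (subtopology zariski V) V"
      unfolding openin_subtopology_zariski_iff
      using polynomial_fun.const[of 1] by (metis order_refl zero_neq_one)
    then show ?thesis
      using openin_subset topspace_subtopology_subset by (metis subset_antisym inf_le2 topspace_subtopology)
  qed
  show "continuous_map (subtopology zariski V) (subtopology zariski W) \<phi>"
    unfolding continuous_map top
  proof (intro conjI allI impI)
    show "\<phi> ` V \<subseteq> W" using \<phi>(2) by blast
    fix T assume T: "openin (subtopology zariski W) T"
    show "openin (subtopology zariski V) {x \<in> V. \<phi> x \<in> T}"
      unfolding openin_subtopology_zariski_iff
    proof (intro conjI ballI)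
      fix a assume a: "a \<in> {x \<in> V. \<phi> x \<in> T}"
      then obtain h where h: "polynomial_fun h" "h (\<phi> a) \<noteq> 0" "\<forall>y\<in>W. h y \<noteq> 0 \<longrightarrow> y \<in> T"
        using T unfolding openin_subtopology_zariski_iff by blast
      have "regular_on V (\<lambda>x. h (\<phi> x))"
        using \<phi>(1) h(1) by (rule regular_on_polynomial_compose)
      then obtain h1 h2 where h': "polynomial_fun h1" "polynomial_fun h2" "h2 a \<noteq> 0"
        "\<forall>x\<in>V. h2 x \<noteq> 0 \<longrightarrow> h (\<phi> x) = h1 x / h2 x"
        using a unfolding regular_on_iff by blast
      show "\<exists>k. polynomial_fun k \<and> k a \<noteq> 0 \<and> (\<forall>x\<in>V. k x \<noteq> 0 \<longrightarrow> x \<in> {x \<in> V. \<phi> x \<in> T})"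
      proof (intro exI conjI)
        show "polynomial_fun (\<lambda>x. h1 x * h2 x)"
          using h' by (auto intro: polynomial_fun.intros)
        show "h1 a * h2 a \<noteq> 0"
          using h' h(2) a by auto
        show "\<forall>x\<in>V. h1 x * h2 x \<noteq> 0 \<longrightarrow> x \<in> {x \<in> V. \<phi> x \<in> T}"
          using h'(4) h(3) \<phi>(2) by auto
      qed
    qed auto
  qed
next
  fix T f assume "openin (subtopology zariski W) T \<and> regular_on T f"
  moreover have "regular_on {x \<in> V. \<phi> x \<in> T} (\<lambda>x. \<phi> x $ i)" for i
    using \<phi>(1) by (rule regular_on_subset) blast
  ultimately show "regular_on {x \<in> V. \<phi> x \<in> T} (f \<circ> \<phi>)"
    unfolding comp_def by (blast intro: regular_on_compose[where W = T])
qed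

text \<open>
  Two fractions \<open>P / g\<close> and \<open>Q / h\<close> that agree, and whose denominators have no common zero, define
  one regular function. All regular functions below that are not polynomials in the coordinates stem from
  this construction.
\<close>

lemma regular_on_glue:
  assumes agree: "\<And>x. x \<in> V \<Longrightarrow> h x * P x = g x * Q x"
    and cover: "\<And>x. x \<in> V \<Longrightarrow> g x \<noteq> 0 \<or> h x \<noteq> 0"
    and reg: "regular_on V g" "regular_on V h" "regular_on V P" "regular_on V Q"
  obtains r where "regular_on V r"
    and "\<And>x. x \<in> V \<Longrightarrow> g x * r x = P x" and "\<And>x. x \<in> V \<Longrightarrow> h x * r x = Q x"
proof
  define r where "r x = (if g x \<noteq> 0 then P x / g x else Q x / h x)" for x
  have r: "g x * r x = P x" "h x * r x = Q x" if "x \<in> V" for x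
    using agree[OF that] cover[OF that] unfolding r_def by (auto simp: field_simps)
  then show "\<And>x. x \<in> V \<Longrightarrow> g x * r x = P x" "\<And>x. x \<in> V \<Longrightarrow> h x * r x = Q x"
    by blast+
  show "regular_on V r"
  proof (rule regular_on_local_quotient)
    fix a assume a: "a \<in> V"
    have "\<forall>x\<in>V. g x \<noteq> 0 \<longrightarrow> r x = P x / g x" "\<forall>x\<in>V. h x \<noteq> 0 \<longrightarrow> r x = Q x / h x"
      using r by (auto simp: field_simps)
    then show "\<exists>g h. regular_on V g \<and> regular_on V h \<and> h a \<noteq> 0
        \<and> (\<forall>x\<in>V. h x \<noteq> 0 \<longrightarrow> r x = g x / h x)"
      using cover[OF a] reg by blast
  qed
qed

section \<open>Cancellation by a line for additive torsors\<close>

lemma eq_if_mult_eq: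
  fixes l r :: complex
  assumes "z \<noteq> 0 \<or> w \<noteq> 0" "z * l = z * r" "w * l = w * r"
  shows "l = r"
  using assms by auto

definition line_fst :: "complex ^ ('n::finite + 1) \<Rightarrow> complex ^ 'n" where
  "line_fst p = (\<chi> i. p $ Inl i)"

definition line_snd :: "complex ^ ('n::finite + 1) \<Rightarrow> complex" where
  "line_snd p = p $ Inr 1"

definition line_pair :: "complex ^ 'n \<Rightarrow> complex \<Rightarrow> complex ^ ('n::finite + 1)" where
  "line_pair p t = (\<chi> k. case k of Inl i \<Rightarrow> p $ i | Inr _ \<Rightarrow> t)"

lemma line_pair_simps [simp]:
  "line_fst (line_pair p t) = p" "line_snd (line_pair p t) = t"
  unfolding line_fst_def line_snd_def line_pair_def by (simp_all add: vec_eq_iff)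

lemma line_eqI:
  assumes "line_fst p = line_fst q" "line_snd p = line_snd q"
  shows "p = q"
proof -
  have "p $ k = q $ k" for k
  proof (cases k)
    case (Inr j)
    then have "k = Inr 1"
      using num1_eq1[of j] by simp
    then show ?thesis
      using assms(2) by (simp add: line_snd_def)
  qed (use assms(1) in \<open>simp add: line_fst_def vec_eq_iff\<close>)
  then show ?thesis
    by (simp add: vec_eq_iff)
qed

lemma mem_times_line_iff: "p \<in> V \<times>\<^sub>v affine_line \<longleftrightarrow> line_fst p \<in> V"
  unfolding product_variety_def affine_line_def line_fst_def by simp

lemma regular_on_line_fst:
  assumes "regular_on V f"
  shows "regular_on (V \<times>\<^sub>v affine_line) (\<lambda>p. f (line_fst p))"
proof (rule regular_on_compose[OF _ _ assms])
  show "regular_on (V \<times>\<^sub>v affine_line) (\<lambda>p. line_fst p $ i)" for i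
    unfolding line_fst_def by (simp add: regular_on_coord)
qed (simp add: mem_times_line_iff)

lemma regular_on_line_snd: "regular_on V line_snd"
  unfolding line_snd_def by (rule regular_on_coord)

lemma morphism_times_lineI:
  assumes "\<And>i. regular_on V (\<lambda>p. f p $ i)" "regular_on V \<sigma>" "\<And>p. p \<in> V \<Longrightarrow> f p \<in> W"
  shows "morphism V (W \<times>\<^sub>v affine_line) (\<lambda>p. line_pair (f p) (\<sigma> p))"
proof (rule morphismI)
  show "regular_on V (\<lambda>p. line_pair (f p) (\<sigma> p) $ k)" for k
    using assms(1,2) unfolding line_pair_def by (cases k) simp_all
qed (simp add: mem_times_line_iff assms(3))

text \<open>
  \<open>P\<close> is given by the equation \<open>a v - b u = c\<close> over the base \<open>B\<close>, that is, by the cocycle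
  \<open>c / (a b)\<close> for the cover of \<open>B\<close> by the open sets where \<open>a\<close> or \<open>b\<close> does not vanish. The map \<open>e\<close>
  assembles a point from its base point and fibre coordinates, and hides how the latter are embedded
  in the coordinates of the ambient space; the last assumption says that it only copies
  coordinates, so that it is regular on families over any variety.
\<close>

locale additive_torsor =
  fixes B :: "(complex ^ 'r) set" and a b c :: "complex ^ 'r \<Rightarrow> complex"
    and P :: "(complex ^ 'n) set" and \<pi> :: "complex ^ 'n \<Rightarrow> complex ^ 'r"
    and u v :: "complex ^ 'n \<Rightarrow> complex"
    and e :: "complex ^ 'r \<Rightarrow> complex \<Rightarrow> complex \<Rightarrow> complex ^ 'n"
  assumes poly: "polynomial_fun a" "polynomial_fun b" "polynomial_fun u" "polynomial_fun v"
      "\<And>i. polynomial_fun (\<lambda>p. \<pi> p $ i)"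
    and no_common_zero: "\<And>s. s \<in> B \<Longrightarrow> a s \<noteq> 0 \<or> b s \<noteq> 0"
    and point: "\<And>p. p \<in> P \<Longrightarrow> \<pi> p \<in> B" "\<And>p. p \<in> P \<Longrightarrow> e (\<pi> p) (u p) (v p) = p"
      "\<And>p. p \<in> P \<Longrightarrow> a (\<pi> p) * v p - b (\<pi> p) * u p = c (\<pi> p)"
    and build: "\<And>s \<mu> \<nu>. s \<in> B \<Longrightarrow> a s * \<nu> - b s * \<mu> = c s \<Longrightarrow> e s \<mu> \<nu> \<in> P"
      "\<And>s \<mu> \<nu>. \<pi> (e s \<mu> \<nu>) = s" "\<And>s \<mu> \<nu>. u (e s \<mu> \<nu>) = \<mu>" "\<And>s \<mu> \<nu>. v (e s \<mu> \<nu>) = \<nu>"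
    and build_coord: "\<And>j. (\<exists>i. \<forall>s \<mu> \<nu>. e s \<mu> \<nu> $ j = s $ i)
      \<or> (\<forall>s \<mu> \<nu>. e s \<mu> \<nu> $ j = \<mu>) \<or> (\<forall>s \<mu> \<nu>. e s \<mu> \<nu> $ j = \<nu>)"
begin

lemma regular_on_build:
  assumes "\<And>i. regular_on V (\<lambda>p. s p $ i)" "regular_on V \<mu>" "regular_on V \<nu>"
  shows "regular_on V (\<lambda>p. e (s p) (\<mu> p) (\<nu> p) $ j)"
  using build_coord[of j] assms by auto

lemma regular_on_total:
  "regular_on V u" "regular_on V v" "regular_on V (\<lambda>p. \<pi> p $ i)"
  "regular_on V (\<lambda>p. a (\<pi> p))" "regular_on V (\<lambda>p. b (\<pi> p))"
  using poly by (auto intro: regular_on_polynomial regular_on_polynomial_compose)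

end

text \<open>
  Over \<open>P\<close> the fibre product of \<open>P\<close> and \<open>Q\<close> is trivialised by the section \<open>(s, t)\<close>: a pair of points
  \<open>(p, q)\<close> corresponds to \<open>(p, \<tau>)\<close> with \<open>u' q = s p + a' \<tau>\<close> and \<open>v' q = t p + b' \<tau>\<close>. Over
  \<open>Q\<close> it is trivialised by \<open>(s', t')\<close> in the same way. The map \<open>\<phi>\<close> below is the transition from the
  first trivialisation to the second. The new line coordinate is regular because it
  is given by a fraction with denominator \<open>a\<close> and by one with denominator \<open>b\<close>.
\<close>

lemma fibre_product_transition:
  fixes P :: "(complex ^ 'n) set" and Q :: "(complex ^ 'm) set"
  assumes P: "additive_torsor B a b c P \<pi> u v e"
    and Q: "additive_torsor B a' b' c' Q \<pi>' u' v' e'"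
    and st: "regular_on P s" "regular_on P t"
      "\<forall>p\<in>P. a' (\<pi> p) * t p - b' (\<pi> p) * s p = c' (\<pi> p)"
    and st': "regular_on Q s'" "regular_on Q t'"
      "\<forall>q\<in>Q. a (\<pi>' q) * t' q - b (\<pi>' q) * s' q = c (\<pi>' q)"
  obtains \<phi> where "morphism (P \<times>\<^sub>v affine_line) (Q \<times>\<^sub>v affine_line) \<phi>"
    and "\<And>w. w \<in> P \<times>\<^sub>v affine_line \<Longrightarrow>
      line_fst (\<phi> w) \<in> Q \<and> \<pi>' (line_fst (\<phi> w)) = \<pi> (line_fst w)
      \<and> u' (line_fst (\<phi> w)) = s (line_fst w) + a' (\<pi> (line_fst w)) * line_snd w
      \<and> v' (line_fst (\<phi> w)) = t (line_fst w) + b' (\<pi> (line_fst w)) * line_snd w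
      \<and> u (line_fst w) = s' (line_fst (\<phi> w)) + a (\<pi> (line_fst w)) * line_snd (\<phi> w)
      \<and> v (line_fst w) = t' (line_fst (\<phi> w)) + b (\<pi> (line_fst w)) * line_snd (\<phi> w)"
proof -
  interpret P: additive_torsor B a b c P \<pi> u v e by (rule P)
  interpret Q: additive_torsor B a' b' c' Q \<pi>' u' v' e' by (rule Q)
  define W where "W = P \<times>\<^sub>v affine_line"
  define p :: "complex ^ ('n + 1) \<Rightarrow> complex ^ 'n" where "p = line_fst"
  define \<mu> where "\<mu> w = s (p w) + a' (\<pi> (p w)) * line_snd w" for w
  define \<nu> where "\<nu> w = t (p w) + b' (\<pi> (p w)) * line_snd w" for w
  define f where "f w = e' (\<pi> (p w)) (\<mu> w) (\<nu> w)" for w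
  have pP: "p w \<in> P" if "w \<in> W" for w
    using that unfolding W_def p_def mem_times_line_iff .
  have pullback: "regular_on W (\<lambda>w. g (p w))" if "regular_on P g" for g
    unfolding W_def p_def using that by (rule regular_on_line_fst)
  have reg_base: "regular_on W (\<lambda>w. \<pi> (p w) $ i)" for i
    by (rule pullback) (rule P.regular_on_total)
  have reg_a': "regular_on W (\<lambda>w. a' (\<pi> (p w)))" and reg_b': "regular_on W (\<lambda>w. b' (\<pi> (p w)))"
    using Q.poly reg_base by (auto intro: regular_on_polynomial_compose)
  have reg_uv: "regular_on W \<mu>" "regular_on W \<nu>"
    unfolding \<mu>_def \<nu>_def
    by (intro regular pullback reg_a' reg_b' st regular_on_line_snd)+
  have reg_f: "regular_on W (\<lambda>w. f w $ j)" for j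
    unfolding f_def by (intro Q.regular_on_build reg_base reg_uv)
  have "a' (\<pi> (p w)) * \<nu> w - b' (\<pi> (p w)) * \<mu> w = c' (\<pi> (p w))" if "w \<in> W" for w
    using st(3)[rule_format, OF pP[OF that]] unfolding \<mu>_def \<nu>_def by (simp add: algebra_simps)
  then have fQ: "f w \<in> Q" if "w \<in> W" for w
    unfolding f_def using Q.build(1) P.point(1) pP that by blast
  have f: "\<pi>' (f w) = \<pi> (p w)" "u' (f w) = \<mu> w" "v' (f w) = \<nu> w" for w
    unfolding f_def by (rule Q.build)+
  have agree: "b (\<pi> (p w)) * (u (p w) - s' (f w)) = a (\<pi> (p w)) * (v (p w) - t' (f w))"
    if "w \<in> W" for w
    using P.point(3)[OF pP[OF that]] st'(3)[rule_format, OF fQ[OF that]] unfolding f by (simp add: algebra_simps)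
  have cover: "a (\<pi> (p w)) \<noteq> 0 \<or> b (\<pi> (p w)) \<noteq> 0" if "w \<in> W" for w
    using P.no_common_zero P.point(1) pP[OF that] by blast
  have reg_st': "regular_on W (\<lambda>w. s' (f w))" "regular_on W (\<lambda>w. t' (f w))"
    using reg_f fQ st' by (auto intro: regular_on_compose)
  obtain \<sigma> where \<sigma>: "regular_on W \<sigma>"
    "\<And>w. w \<in> W \<Longrightarrow> a (\<pi> (p w)) * \<sigma> w = u (p w) - s' (f w)"
    "\<And>w. w \<in> W \<Longrightarrow> b (\<pi> (p w)) * \<sigma> w = v (p w) - t' (f w)"
    by (rule regular_on_glue[where V = W], erule agree, erule cover)
       ((intro regular reg_st' pullback P.regular_on_total)+, rule that)
  show ?thesis
  proof
    show "morphism (P \<times>\<^sub>v affine_line) (Q \<times>\<^sub>v affine_line) (\<lambda>w. line_pair (f w) (\<sigma> w))"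
      using reg_f \<sigma>(1) fQ unfolding W_def by (rule morphism_times_lineI)
  qed (use f fQ \<sigma>(2,3) in \<open>simp_all add: W_def p_def \<mu>_def \<nu>_def\<close>)
qed

text \<open>
  The description of the transition map is symmetric in \<open>P\<close> and \<open>Q\<close> and determines the image
  point, so the two transition maps are inverse to each other.
\<close>

lemma additive_torsor_times_line_isomorphic:
  fixes P :: "(complex ^ 'n) set" and Q :: "(complex ^ 'm) set"
  assumes P: "additive_torsor B a b c P \<pi> u v e"
    and Q: "additive_torsor B a' b' c' Q \<pi>' u' v' e'"
    and st: "regular_on P s" "regular_on P t"
      "\<forall>p\<in>P. a' (\<pi> p) * t p - b' (\<pi> p) * s p = c' (\<pi> p)"
    and st': "regular_on Q s'" "regular_on Q t'"
      "\<forall>q\<in>Q. a (\<pi>' q) * t' q - b (\<pi>' q) * s' q = c (\<pi>' q)"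
  shows "P \<times>\<^sub>v affine_line \<cong>\<^sub>v Q \<times>\<^sub>v affine_line"
proof -
  interpret P: additive_torsor B a b c P \<pi> u v e by (rule P)
  interpret Q: additive_torsor B a' b' c' Q \<pi>' u' v' e' by (rule Q)
  obtain \<phi> where \<phi>: "morphism (P \<times>\<^sub>v affine_line) (Q \<times>\<^sub>v affine_line) \<phi>"
    and \<phi>_eq: "\<And>w. w \<in> P \<times>\<^sub>v affine_line \<Longrightarrow>
      line_fst (\<phi> w) \<in> Q \<and> \<pi>' (line_fst (\<phi> w)) = \<pi> (line_fst w)
      \<and> u' (line_fst (\<phi> w)) = s (line_fst w) + a' (\<pi> (line_fst w)) * line_snd w
      \<and> v' (line_fst (\<phi> w)) = t (line_fst w) + b' (\<pi> (line_fst w)) * line_snd w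
      \<and> u (line_fst w) = s' (line_fst (\<phi> w)) + a (\<pi> (line_fst w)) * line_snd (\<phi> w)
      \<and> v (line_fst w) = t' (line_fst (\<phi> w)) + b (\<pi> (line_fst w)) * line_snd (\<phi> w)"
    by (rule fibre_product_transition[OF P Q st st']) (rule that)
  obtain \<psi> where \<psi>: "morphism (Q \<times>\<^sub>v affine_line) (P \<times>\<^sub>v affine_line) \<psi>"
    and \<psi>_eq: "\<And>w. w \<in> Q \<times>\<^sub>v affine_line \<Longrightarrow>
      line_fst (\<psi> w) \<in> P \<and> \<pi> (line_fst (\<psi> w)) = \<pi>' (line_fst w)
      \<and> u (line_fst (\<psi> w)) = s' (line_fst w) + a (\<pi>' (line_fst w)) * line_snd w
      \<and> v (line_fst (\<psi> w)) = t' (line_fst w) + b (\<pi>' (line_fst w)) * line_snd w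
      \<and> u' (line_fst w) = s (line_fst (\<psi> w)) + a' (\<pi>' (line_fst w)) * line_snd (\<psi> w)
      \<and> v' (line_fst w) = t (line_fst (\<psi> w)) + b' (\<pi>' (line_fst w)) * line_snd (\<psi> w)"
    by (rule fibre_product_transition[OF Q P st' st]) (rule that)
  have "\<psi> (\<phi> w) = w" if w: "w \<in> P \<times>\<^sub>v affine_line" for w
  proof -
    have "\<phi> w \<in> Q \<times>\<^sub>v affine_line" "line_fst w \<in> P"
      using \<phi>_eq[OF w] w by (simp_all add: mem_times_line_iff)
    note eqs = \<phi>_eq[OF w] \<psi>_eq[OF this(1)] and wP = this(2)
    have fst: "line_fst (\<psi> (\<phi> w)) = line_fst w"
      using P.point(2)[OF wP] P.point(2)[of "line_fst (\<psi> (\<phi> w))"] eqs by metis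
    have base: "\<pi>' (line_fst (\<phi> w)) = \<pi> (line_fst w)"
      using eqs by blast
    have "u' (line_fst (\<phi> w)) = s (line_fst w) + a' (\<pi> (line_fst w)) * line_snd w"
      "v' (line_fst (\<phi> w)) = t (line_fst w) + b' (\<pi> (line_fst w)) * line_snd w"
      "u' (line_fst (\<phi> w)) = s (line_fst w) + a' (\<pi> (line_fst w)) * line_snd (\<psi> (\<phi> w))"
      "v' (line_fst (\<phi> w)) = t (line_fst w) + b' (\<pi> (line_fst w)) * line_snd (\<psi> (\<phi> w))"
      using eqs unfolding fst base by blast+
    then have "a' (\<pi> (line_fst w)) * line_snd (\<psi> (\<phi> w)) = a' (\<pi> (line_fst w)) * line_snd w"
      "b' (\<pi> (line_fst w)) * line_snd (\<psi> (\<phi> w)) = b' (\<pi> (line_fst w)) * line_snd w"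
      by (metis add_left_cancel)+
    then have "line_snd (\<psi> (\<phi> w)) = line_snd w"
      by (rule eq_if_mult_eq[OF Q.no_common_zero[OF P.point(1)[OF wP]]])
    with fst show ?thesis by (rule line_eqI)
  qed
  moreover have "\<phi> (\<psi> w) = w" if w: "w \<in> Q \<times>\<^sub>v affine_line" for w
  proof -
    have "\<psi> w \<in> P \<times>\<^sub>v affine_line" "line_fst w \<in> Q"
      using \<psi>_eq[OF w] w by (simp_all add: mem_times_line_iff)
    note eqs = \<psi>_eq[OF w] \<phi>_eq[OF this(1)] and wQ = this(2)
    have fst: "line_fst (\<phi> (\<psi> w)) = line_fst w"
      using Q.point(2)[OF wQ] Q.point(2)[of "line_fst (\<phi> (\<psi> w))"] eqs by metis
    have base: "\<pi> (line_fst (\<psi> w)) = \<pi>' (line_fst w)"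
      using eqs by blast
    have "u (line_fst (\<psi> w)) = s' (line_fst w) + a (\<pi>' (line_fst w)) * line_snd w"
      "v (line_fst (\<psi> w)) = t' (line_fst w) + b (\<pi>' (line_fst w)) * line_snd w"
      "u (line_fst (\<psi> w)) = s' (line_fst w) + a (\<pi>' (line_fst w)) * line_snd (\<phi> (\<psi> w))"
      "v (line_fst (\<psi> w)) = t' (line_fst w) + b (\<pi>' (line_fst w)) * line_snd (\<phi> (\<psi> w))"
      using eqs unfolding fst base by blast+
    then have "a (\<pi>' (line_fst w)) * line_snd (\<phi> (\<psi> w)) = a (\<pi>' (line_fst w)) * line_snd w"
      "b (\<pi>' (line_fst w)) * line_snd (\<phi> (\<psi> w)) = b (\<pi>' (line_fst w)) * line_snd w"
      by (metis add_left_cancel)+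
    then have "line_snd (\<phi> (\<psi> w)) = line_snd w"
      by (rule eq_if_mult_eq[OF P.no_common_zero[OF Q.point(1)[OF wQ]]])
    with fst show ?thesis by (rule line_eqI)
  qed
  ultimately show ?thesis
    unfolding isomorphic_def using \<phi> \<psi> by blast
qed

section \<open>Ideals generated by two regular functions\<close>

definition in_ideal ::
  "(complex ^ 'n) set \<Rightarrow> (complex ^ 'n \<Rightarrow> complex) \<Rightarrow> (complex ^ 'n \<Rightarrow> complex)
     \<Rightarrow> (complex ^ 'n \<Rightarrow> complex) \<Rightarrow> bool" where
  "in_ideal V x y f \<longleftrightarrow>
     (\<exists>\<alpha> \<beta>. regular_on V \<alpha> \<and> regular_on V \<beta> \<and> (\<forall>p\<in>V. f p = \<alpha> p * x p + \<beta> p * y p))"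

definition in_radical ::
  "(complex ^ 'n) set \<Rightarrow> (complex ^ 'n \<Rightarrow> complex) \<Rightarrow> (complex ^ 'n \<Rightarrow> complex)
     \<Rightarrow> (complex ^ 'n \<Rightarrow> complex) \<Rightarrow> bool" where
  "in_radical V x y f \<longleftrightarrow> regular_on V f \<and> (\<exists>n. in_ideal V x y (\<lambda>p. f p ^ n))"

lemma in_ideal_combination:
  assumes "in_ideal V x y f" "in_ideal V x y g" "regular_on V a" "regular_on V b"
    and h: "\<And>p. p \<in> V \<Longrightarrow> h p = f p * a p + g p * b p"
  shows "in_ideal V x y h"
proof -
  obtain f1 f2 where f: "regular_on V f1" "regular_on V f2" "\<forall>p\<in>V. f p = f1 p * x p + f2 p * y p"
    using assms(1) unfolding in_ideal_def by blast
  obtain g1 g2 where g: "regular_on V g1" "regular_on V g2" "\<forall>p\<in>V. g p = g1 p * x p + g2 p * y p"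
    using assms(2) unfolding in_ideal_def by blast
  show ?thesis
    unfolding in_ideal_def
  proof (intro exI conjI ballI)
    show "regular_on V (\<lambda>p. f1 p * a p + g1 p * b p)" "regular_on V (\<lambda>p. f2 p * a p + g2 p * b p)"
      by (intro regular f g assms)+
    show "h p = (f1 p * a p + g1 p * b p) * x p + (f2 p * a p + g2 p * b p) * y p" if "p \<in> V" for p
      using f(3) g(3) h that by (simp add: algebra_simps)
  qed
qed

text \<open>
  Every term of the binomial expansion of \<open>(f + g)\<^sup>n\<^sup>+\<^sup>m\<close> is divisible by \<open>f\<^sup>n\<close> or by \<open>g\<^sup>m\<close>. This gives
  closure of radicals under addition, and the passage from generators to their powers.
\<close>

lemma regular_power_split:
  assumes "regular_on V f" "regular_on V g"
  shows "\<exists>A B. regular_on V A \<and> regular_on V B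
    \<and> (\<forall>p. (f p + g p) ^ (n + m) = f p ^ n * A p + g p ^ m * B p)"
proof (induction "n + m" arbitrary: n m)
  case (0 n m)
  then show ?case
    by (intro exI[of _ "\<lambda>_. 1"] exI[of _ "\<lambda>_. 0"]) (auto intro: regular)
next
  case (Suc k n m)
  consider "n = 0" | "m = 0" | n' m' where "n = Suc n'" "m = Suc m'"
    by (metis not0_implies_Suc)
  then show ?case
  proof cases
    case 1
    then show ?thesis
      by (intro exI[of _ "\<lambda>p. (f p + g p) ^ m"] exI[of _ "\<lambda>_. 0"]) (auto intro!: regular assms)
  next
    case 2
    then show ?thesis
      by (intro exI[of _ "\<lambda>_. 0"] exI[of _ "\<lambda>p. (f p + g p) ^ n"]) (auto intro!: regular assms)
  next
    case 3
    obtain A B where AB: "regular_on V A" "regular_on V B"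
      "\<And>p. (f p + g p) ^ (n' + m) = f p ^ n' * A p + g p ^ m * B p"
      using Suc.hyps(1)[of n' m] Suc.hyps(2) 3 by auto
    obtain C D where CD: "regular_on V C" "regular_on V D"
      "\<And>p. (f p + g p) ^ (n + m') = f p ^ n * C p + g p ^ m' * D p"
      using Suc.hyps(1)[of n m'] Suc.hyps(2) 3 by auto
    show ?thesis
    proof (intro exI conjI allI)
      show "regular_on V (\<lambda>p. A p + g p * C p)" "regular_on V (\<lambda>p. f p * B p + D p)"
        by (intro regular assms AB CD)+
      fix p
      have "(f p + g p) ^ (n + m) = f p * (f p + g p) ^ (n' + m) + g p * (f p + g p) ^ (n + m')"
        using 3 by (simp add: algebra_simps)
      also have "\<dots> = f p ^ n * (A p + g p * C p) + g p ^ m * (f p * B p + D p)"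
        unfolding AB(3) CD(3) using 3 by (simp add: algebra_simps)
      finally show "(f p + g p) ^ (n + m) = \<dots>" .
    qed
  qed
qed

lemma in_radical_generator:
  assumes "regular_on V x" "regular_on V y"
  shows "in_radical V x y x" "in_radical V x y y"
proof -
  have "in_ideal V x y (\<lambda>p. x p ^ 1)"
    unfolding in_ideal_def
    by (intro exI[of _ "\<lambda>_. 1"] exI[of _ "\<lambda>_. 0"]) (auto intro: regular)
  then show "in_radical V x y x"
    unfolding in_radical_def using assms by blast
  have "in_ideal V x y (\<lambda>p. y p ^ 1)"
    unfolding in_ideal_def
    by (intro exI[of _ "\<lambda>_. 0"] exI[of _ "\<lambda>_. 1"]) (auto intro: regular)
  then show "in_radical V x y y"
    unfolding in_radical_def using assms by blast
qed

lemma in_radical_mult: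
  assumes "in_radical V x y f" "regular_on V g"
  shows "in_radical V x y (\<lambda>p. f p * g p)"
proof -
  obtain n where n: "in_ideal V x y (\<lambda>p. f p ^ n)"
    using assms(1) unfolding in_radical_def by blast
  have "in_ideal V x y (\<lambda>p. (f p * g p) ^ n)"
    by (rule in_ideal_combination[OF n n, where a = "\<lambda>p. g p ^ n" and b = "\<lambda>_. 0"])
      (auto intro: regular assms simp: power_mult_distrib)
  then show ?thesis
    using assms unfolding in_radical_def by (blast intro: regular)
qed

lemma in_radical_add:
  assumes "in_radical V x y f" "in_radical V x y g"
  shows "in_radical V x y (\<lambda>p. f p + g p)"
proof -
  have fg: "regular_on V f" "regular_on V g"
    using assms unfolding in_radical_def by blast+
  obtain n m where nm: "in_ideal V x y (\<lambda>p. f p ^ n)" "in_ideal V x y (\<lambda>p. g p ^ m)"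
    using assms unfolding in_radical_def by blast
  obtain A B where "regular_on V A" "regular_on V B"
    "\<forall>p. (f p + g p) ^ (n + m) = f p ^ n * A p + g p ^ m * B p"
    using regular_power_split[OF fg] by blast
  then have "in_ideal V x y (\<lambda>p. (f p + g p) ^ (n + m))"
    using nm by (intro in_ideal_combination[OF nm]) auto
  then show ?thesis
    unfolding in_radical_def using regular_on_add[OF fg] by blast
qed

lemma in_radical_diff:
  assumes "in_radical V x y f" "in_radical V x y g"
  shows "in_radical V x y (\<lambda>p. f p - g p)"
  using in_radical_add[OF assms(1) in_radical_mult[OF assms(2) regular_on_const[of V "-1"]]]
  by simp

lemma in_radical_root:
  assumes "in_radical V x y g" "regular_on V f" "\<And>p. p \<in> V \<Longrightarrow> f p ^ k = g p"
  shows "in_radical V x y f"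
proof -
  obtain n where "in_ideal V x y (\<lambda>p. g p ^ n)"
    using assms(1) unfolding in_radical_def by blast
  then have "in_ideal V x y (\<lambda>p. f p ^ (k * n))"
    using assms(3) unfolding in_ideal_def by (simp add: power_mult)
  then show ?thesis
    using assms(2) unfolding in_radical_def by blast
qed

lemma unit_ideal_powers:
  assumes "regular_on V x" "regular_on V y" and unit: "in_ideal V x y (\<lambda>_. 1)"
  shows "in_ideal V (\<lambda>p. x p ^ n) (\<lambda>p. y p ^ m) (\<lambda>_. 1)"
proof -
  obtain \<alpha> \<beta> where ab: "regular_on V \<alpha>" "regular_on V \<beta>" "\<forall>p\<in>V. 1 = \<alpha> p * x p + \<beta> p * y p"
    using unit unfolding in_ideal_def by blast
  obtain A B where AB: "regular_on V A" "regular_on V B"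
    "\<forall>p. (\<alpha> p * x p + \<beta> p * y p) ^ (n + m) = (\<alpha> p * x p) ^ n * A p + (\<beta> p * y p) ^ m * B p"
    using regular_power_split[of V "\<lambda>p. \<alpha> p * x p" "\<lambda>p. \<beta> p * y p" n m]
      ab(1,2) assms(1,2) by (blast intro: regular)
  show ?thesis
    unfolding in_ideal_def
  proof (intro exI conjI ballI)
    show "regular_on V (\<lambda>p. \<alpha> p ^ n * A p)" "regular_on V (\<lambda>p. \<beta> p ^ m * B p)"
      by (intro regular ab AB)+
    fix p assume "p \<in> V"
    then have "1 = (\<alpha> p * x p + \<beta> p * y p) ^ (n + m)"
      using ab(3) by (metis power_one)
    then show "1 = \<alpha> p ^ n * A p * x p ^ n + \<beta> p ^ m * B p * y p ^ m"
      using AB(3) by (simp add: power_mult_distrib algebra_simps)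
  qed
qed

section \<open>The coordinate ring of the icosahedral torsor\<close>

text \<open>
  Let \<open>\<Gamma>\<close> be the binary icosahedral group in \<open>SL\<^sub>2\<close>. The surface \<open>x\<^sup>2 + y\<^sup>3 + z\<^sup>5 = 0\<close> is
  the quotient of the plane by \<open>\<Gamma>\<close>, with \<open>x\<close>, \<open>y\<close>, \<open>z\<close> multiples of Klein's invariant forms of
  degrees 30, 20 and 12, and the torsor \<open>x v - y u = z\<^sup>4\<close> over its punctured version is
  \<open>SL\<^sub>2 / \<Gamma>\<close>, which is affine. On \<open>SL\<^sub>2\<close>, with \<open>\<xi>\<close>, \<open>\<eta>\<close> the columns of a matrix, the coefficients
  of the polynomials \<open>x (\<xi> + t \<eta>)\<close>, \<open>y (\<xi> + t \<eta>)\<close>, \<open>z (\<xi> + t \<eta>)\<close> in \<open>t\<close> are \<open>\<Gamma>\<close>-invariant, and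
  hence functions on the torsor. Up to binomial factors, \<open>u\<close>, \<open>v\<close>, \<open>w\<close> below are the coefficients
  of \<open>t\<close> in the three of them, \<open>c\<close> is that of \<open>t\<^sup>2\<close> in the second, and \<open>a\<^sub>i\<close> is that of \<open>t\<^sup>i\<close> in the
  third, with \<open>a\<^sub>0 = z\<close>, \<open>a\<^sub>1 = w\<close> and \<open>a\<^sub>6\<close> shifted to \<open>e = a\<^sub>6 + 144 / 7\<close>.

  The coefficients of a form in the \<open>SL\<^sub>2\<close>-orbit of Klein's form \<open>f\<close> satisfy many quadratic
  relations: the transvectants \<open>(f, f)\<^sub>4\<close>, \<open>(f, f)\<^sub>8\<close>, \<open>(f, f)\<^sub>1\<^sub>0\<close> vanish, \<open>(f, f)\<^sub>2\<close> and \<open>(f, f)\<^sub>6\<close> are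
  multiples of \<open>y\<close> and \<open>f\<close>, and \<open>(f, f)\<^sub>1\<^sub>2\<close> is a nonzero constant. These relations serve twice. For
  \<open>i \<ge> 5\<close> they express \<open>z a\<^sub>i\<close> and \<open>w a\<^sub>i\<close> in terms of earlier coefficients; since \<open>z\<close> and \<open>w\<close> never
  vanish together, this proves \<open>a\<^sub>i\<close> regular without any reference to \<open>\<Gamma>\<close>. They also put powers of
  \<open>a\<^sub>2\<close>, \<open>a\<^sub>3\<close>, \<open>a\<^sub>4\<close>, \<open>a\<^sub>5\<close> successively into the ideal of \<open>x\<close> and \<open>y\<close>. After that, three relations of
  weight zero, namely those for \<open>w a\<^sub>1\<^sub>1\<close>, \<open>a\<^sub>4 a\<^sub>8\<close> and \<open>a\<^sub>3 a\<^sub>9\<close>, impose incompatible conditions on \<open>e\<close>.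
\<close>

lemma icosahedral_unit_ideal:
  assumes reg: "regular_on V x" "regular_on V y" "regular_on V z" "regular_on V u" "regular_on V v"
    and S: "\<And>p. p \<in> V \<Longrightarrow> x p ^ 2 + y p ^ 3 + z p ^ 5 = 0"
    and T: "\<And>p. p \<in> V \<Longrightarrow> x p * v p - y p * u p = z p ^ 4"
    and ne: "\<And>p. p \<in> V \<Longrightarrow> x p \<noteq> 0 \<or> y p \<noteq> 0"
  shows "in_ideal V x y (\<lambda>_. 1)"
proof -
  have ne_xz: "x p \<noteq> 0 \<or> z p \<noteq> 0" and ne_zy: "z p \<noteq> 0 \<or> y p \<noteq> 0" if "p \<in> V" for p
    using S[OF that] ne[OF that] by auto
  have agree: "y p * (z p * u p - y p^2) = x p * (z p * v p + x p)" if "p \<in> V" for p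
    using S[OF that] T[OF that] by algebra
  obtain w where reg_w: "regular_on V w"
    and wx: "\<And>p. p \<in> V \<Longrightarrow> x p * w p = z p * u p - y p^2"
    and wy: "\<And>p. p \<in> V \<Longrightarrow> y p * w p = z p * v p + x p"
    by (rule regular_on_glue[where V = V], erule agree, erule ne)
       ((intro regular reg)+, rule that)
  note reg = reg reg_w
  have agree: "z p * (u p * w p - y p * v p) = x p * (w p^2 + y p)" if "p \<in> V" for p
    using wx[OF that] wy[OF that] by algebra
  obtain a2 where reg_a2: "regular_on V a2"
    and a2x: "\<And>p. p \<in> V \<Longrightarrow> x p * a2 p = u p * w p - y p * v p"
    and a2z: "\<And>p. p \<in> V \<Longrightarrow> z p * a2 p = w p^2 + y p"
    by (rule regular_on_glue[where V = V], erule agree, erule ne_xz)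
       ((intro regular reg)+, rule that)
  note reg = reg reg_a2
  have ne_zw: "z p \<noteq> 0 \<or> w p \<noteq> 0" if "p \<in> V" for p
    using a2z[OF that] ne_zy[OF that] by auto
  have a2y: "y p * a2 p = v p * w p + u p" if "p \<in> V" for p
  proof -
    have "x p * (y p * a2 p) = x p * (v p * w p + u p)"
      using wx[OF that] wy[OF that] a2x[OF that] by algebra
    moreover have "z p * (y p * a2 p) = z p * (v p * w p + u p)"
      using wx[OF that] wy[OF that] a2z[OF that] by algebra
    ultimately show ?thesis
      using ne_xz[OF that] by (rule eq_if_mult_eq[rotated 1])
  qed
  have agree: "y p * (u p * v p + z p^3 * w p) = x p * (v p^2 + z p^3)" if "p \<in> V" for p
    using T[OF that] wy[OF that] by algebra
  obtain c where reg_c: "regular_on V c"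
    and cx: "\<And>p. p \<in> V \<Longrightarrow> x p * c p = u p * v p + z p^3 * w p"
    and cy: "\<And>p. p \<in> V \<Longrightarrow> y p * c p = v p^2 + z p^3"
    by (rule regular_on_glue[where V = V], erule agree, erule ne)
       ((intro regular reg)+, rule that)
  note reg = reg reg_c
  have cz: "z p * c p = v p * w p - u p" if "p \<in> V" for p
  proof -
    have "x p * (z p * c p) = x p * (v p * w p - u p)"
      using T[OF that] wy[OF that] cx[OF that] by algebra
    moreover have "y p * (z p * c p) = y p * (v p * w p - u p)"
      using T[OF that] wy[OF that] cy[OF that] by algebra
    ultimately show ?thesis
      using ne[OF that] by (rule eq_if_mult_eq[rotated 1])
  qed
  have agree: "w p * (w p * a2 p + 2 * v p) = z p * (c p + a2 p^2)" if "p \<in> V" for p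
    using a2y[OF that] cz[OF that] a2z[OF that] by algebra
  obtain a3 where reg_a3: "regular_on V a3"
    and a3z: "\<And>p. p \<in> V \<Longrightarrow> z p * a3 p = w p * a2 p + 2 * v p"
    and a3w: "\<And>p. p \<in> V \<Longrightarrow> w p * a3 p = c p + a2 p^2"
    by (rule regular_on_glue[where V = V], erule agree, erule ne_zw)
       ((intro regular reg)+, rule that)
  note reg = reg reg_a3
  have agree: "y p * (4 * c p + a2 p^2)
      = z p * (2 * v p * a3 p + 4 * z p^2 - a2 p * c p)" if "p \<in> V" for p
    using cy[OF that] a2y[OF that] cz[OF that] a3z[OF that] by algebra
  obtain a4 where reg_a4: "regular_on V a4"
    and a4z: "\<And>p. p \<in> V \<Longrightarrow> z p * a4 p = 4 * c p + a2 p^2"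
    and a4y: "\<And>p. p \<in> V \<Longrightarrow> y p * a4 p = 2 * v p * a3 p + 4 * z p^2 - a2 p * c p"
    by (rule regular_on_glue[where V = V], erule agree, erule ne_zy)
       ((intro regular reg)+, rule that)
  note reg = reg reg_a4
  have agree: "w p * (3 * w p * a4 p - 2 * a2 p * a3 p)
      = z p * (4 * a2 p * a4 p - 3 * a3 p^2 - 12 * z p)" if "p \<in> V" for p
    using a4y[OF that] a2z[OF that] a3z[OF that] a3w[OF that] a4z[OF that] by algebra
  obtain a5 where reg_a5: "regular_on V a5"
    and a5z: "\<And>p. p \<in> V \<Longrightarrow> z p * a5 p = 3 * w p * a4 p - 2 * a2 p * a3 p"
    and a5w: "\<And>p. p \<in> V \<Longrightarrow> w p * a5 p = 4 * a2 p * a4 p - 3 * a3 p^2 - 12 * z p"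
    by (rule regular_on_glue[where V = V], erule agree, erule ne_zw)
       ((intro regular reg)+, rule that)
  note reg = reg reg_a5
  have agree: "w p * (9 * a2 p * a4 p - 8 * a3 p^2)
      = z p * (3 * a2 p * a5 p - 2 * a3 p * a4 p)" if "p \<in> V" for p
    using a3w[OF that] a4z[OF that] a5z[OF that] by algebra
  obtain e where reg_e: "regular_on V e"
    and ez: "\<And>p. p \<in> V \<Longrightarrow> z p * e p = 9 * a2 p * a4 p - 8 * a3 p^2"
    and ew: "\<And>p. p \<in> V \<Longrightarrow> w p * e p = 3 * a2 p * a5 p - 2 * a3 p * a4 p"
    by (rule regular_on_glue[where V = V], erule agree, erule ne_zw)
       ((intro regular reg)+, rule that)
  note reg = reg reg_e
  have agree: "w p * (6 * a2 p * a5 p - 5 * a3 p * a4 p)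
      = z p * (9 * a3 p * a5 p - 8 * a4 p^2 - 72 * a2 p)" if "p \<in> V" for p
    using a3w[OF that] a4z[OF that] a5z[OF that] a5w[OF that] by algebra
  obtain a7 where reg_a7: "regular_on V a7"
    and a7z: "\<And>p. p \<in> V \<Longrightarrow> z p * a7 p = 6 * a2 p * a5 p - 5 * a3 p * a4 p"
    and a7w: "\<And>p. p \<in> V \<Longrightarrow> w p * a7 p = 9 * a3 p * a5 p - 8 * a4 p^2 - 72 * a2 p"
    by (rule regular_on_glue[where V = V], erule agree, erule ne_zw)
       ((intro regular reg)+, rule that)
  note reg = reg reg_a7
  have a2e: "a2 p * e p = 4 * a3 p * a5 p - 3 * a4 p^2" if "p \<in> V" for p
  proof -
    have "z p * (a2 p * e p) = z p * (4 * a3 p * a5 p - 3 * a4 p^2)"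
      using a3w[OF that] a4z[OF that] a5z[OF that] ez[OF that] by algebra
    moreover have "w p * (a2 p * e p) = w p * (4 * a3 p * a5 p - 3 * a4 p^2)"
      using a3w[OF that] a4z[OF that] a5z[OF that] ew[OF that] by algebra
    ultimately show ?thesis
      using ne_zw[OF that] by (rule eq_if_mult_eq[rotated 1])
  qed
  have agree: "w p * (16 * a3 p * a5 p - 15 * a4 p^2)
      = z p * (6 * a3 p * e p - 192 * a3 p - 5 * a4 p * a5 p)" if "p \<in> V" for p
    using a5z[OF that] a5w[OF that] ez[OF that] by algebra
  obtain a8 where reg_a8: "regular_on V a8"
    and a8z: "\<And>p. p \<in> V \<Longrightarrow> z p * a8 p = 16 * a3 p * a5 p - 15 * a4 p^2"
    and a8w: "\<And>p. p \<in> V \<Longrightarrow> w p * a8 p = 6 * a3 p * e p - 192 * a3 p - 5 * a4 p * a5 p"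
    by (rule regular_on_glue[where V = V], erule agree, erule ne_zw)
       ((intro regular reg)+, rule that)
  note reg = reg reg_a8
  have agree: "w p * (10 * a3 p * e p - 9 * a4 p * a5 p)
      = z p * (16 * a4 p * e p - 15 * a5 p^2 - 432 * a4 p)" if "p \<in> V" for p
    using a5z[OF that] a5w[OF that] ez[OF that] ew[OF that] by algebra
  obtain a9 where reg_a9: "regular_on V a9"
    and a9z: "\<And>p. p \<in> V \<Longrightarrow> z p * a9 p = 10 * a3 p * e p - 9 * a4 p * a5 p"
    and a9w: "\<And>p. p \<in> V \<Longrightarrow> w p * a9 p = 16 * a4 p * e p - 15 * a5 p^2 - 432 * a4 p"
    by (rule regular_on_glue[where V = V], erule agree, erule ne_zw)
       ((intro regular reg)+, rule that)
  note reg = reg reg_a9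
  have agree: "w p * (15 * a4 p * a7 p - 14 * a5 p * e p + 1728 * a5 p)
      = z p * (25 * a5 p * a7 p - 24 * (e p - 32) * (e p - 27))" if "p \<in> V" for p
    using a5w[OF that] ez[OF that] ew[OF that] a7z[OF that] a7w[OF that] a2e[OF that] by algebra
  obtain a11 where reg_a11: "regular_on V a11"
    and a11z: "\<And>p. p \<in> V \<Longrightarrow> z p * a11 p = 15 * a4 p * a7 p - 14 * a5 p * e p + 1728 * a5 p"
    and a11w: "\<And>p. p \<in> V \<Longrightarrow> w p * a11 p = 25 * a5 p * a7 p - 24 * (e p - 32) * (e p - 27)"
    by (rule regular_on_glue[where V = V], erule agree, erule ne_zw)
       ((intro regular reg)+, rule that)
  note reg = reg reg_a11
  have a4a8: "a4 p * a8 p = 4 * a5 p * a7 p - 3 * e p * (e p - 32)" if "p \<in> V" for p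
  proof -
    have "z p * (a4 p * a8 p) = z p * (4 * a5 p * a7 p - 3 * e p * (e p - 32))"
      using a5w[OF that] ez[OF that] ew[OF that] a7z[OF that] a2e[OF that] a8z[OF that] by algebra
    moreover have "w p * (a4 p * a8 p) = w p * (4 * a5 p * a7 p - 3 * e p * (e p - 32))"
      using ew[OF that] a7w[OF that] a2e[OF that] a8w[OF that] by algebra
    ultimately show ?thesis
      using ne_zw[OF that] by (rule eq_if_mult_eq[rotated 1])
  qed
  have a3a9: "a3 p * a9 p = 9 * a5 p * a7 p - 8 * e p * (e p - 27)" if "p \<in> V" for p
  proof -
    have "z p * (a3 p * a9 p) = z p * (9 * a5 p * a7 p - 8 * e p * (e p - 27))"
      using a5w[OF that] ez[OF that] ew[OF that] a7z[OF that] a9z[OF that] by algebra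
    moreover have "w p * (a3 p * a9 p) = w p * (9 * a5 p * a7 p - 8 * e p * (e p - 27))"
      using ew[OF that] a7w[OF that] a2e[OF that] a9w[OF that] by algebra
    ultimately show ?thesis
      using ne_zw[OF that] by (rule eq_if_mult_eq[rotated 1])
  qed

  \<comment> \<open>Each function has a power in the ideal generated by those before it: the pure square of
    \<open>a\<^sub>i\<close> occurs in a relation all of whose other terms contain an earlier coefficient.\<close>
  have rx: "in_radical V x y x" and ry: "in_radical V x y y"
    using reg by (auto intro: in_radical_generator)
  have rz: "in_radical V x y z"
  proof (rule in_radical_root)
    show "in_radical V x y (\<lambda>p. x p * (- x p) - y p * (y p^2))"
      by (intro in_radical_add in_radical_diff in_radical_mult rx ry regular reg)
    show "z p ^ 5 = x p * (- x p) - y p * (y p^2)" if "p \<in> V" for p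
      using S[OF that] by algebra
  qed (rule reg)
  have rw: "in_radical V x y w"
  proof (rule in_radical_root)
    show "in_radical V x y (\<lambda>p. z p * a2 p - y p)"
      by (intro in_radical_add in_radical_diff in_radical_mult ry rz regular reg)
    show "w p ^ 2 = z p * a2 p - y p" if "p \<in> V" for p
      using a2z[OF that] by algebra
  qed (rule reg)
  have ra2: "in_radical V x y a2"
  proof (rule in_radical_root)
    show "in_radical V x y (\<lambda>p. w p * a3 p * (4/3) - z p * a4 p * (1/3))"
      by (intro in_radical_add in_radical_diff in_radical_mult rz rw regular reg)
    show "a2 p ^ 2 = w p * a3 p * (4/3) - z p * a4 p * (1/3)" if "p \<in> V" for p
      using a3w[OF that] a4z[OF that] by algebra
  qed (rule reg)
  have ra3: "in_radical V x y a3"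
  proof (rule in_radical_root)
    show "in_radical V x y (\<lambda>p. a2 p * (a4 p * (4/3)) - z p * 4 - w p * (a5 p * (1/3)))"
      by (intro in_radical_add in_radical_diff in_radical_mult rz rw ra2 regular reg)
    show "a3 p ^ 2 = a2 p * (a4 p * (4/3)) - z p * 4 - w p * (a5 p * (1/3))" if "p \<in> V" for p
      using a5w[OF that] by algebra
  qed (rule reg)
  have ra4: "in_radical V x y a4"
  proof (rule in_radical_root)
    show "in_radical V x y (\<lambda>p. a3 p * (a5 p * (4/3)) - a2 p * (e p * (1/3)))"
      by (intro in_radical_add in_radical_diff in_radical_mult ra3 ra2 regular reg)
    show "a4 p ^ 2 = a3 p * (a5 p * (4/3)) - a2 p * (e p * (1/3))" if "p \<in> V" for p
      using a2e[OF that] by algebra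
  qed (rule reg)
  have ra5: "in_radical V x y a5"
  proof (rule in_radical_root)
    show "in_radical V x y (\<lambda>p. a4 p * (e p * (16/15)) - a4 p * (432/15) - w p * (a9 p * (1/15)))"
      by (intro in_radical_add in_radical_diff in_radical_mult ra4 rw regular reg)
    show "a5 p ^ 2 = a4 p * (e p * (16/15)) - a4 p * (432/15) - w p * (a9 p * (1/15))" if "p \<in> V" for p
      using a9w[OF that] by algebra
  qed (rule reg)
  \<comment> \<open>Modulo the radical the last three relations leave the equations \<open>(e - 32) (e - 27) = 0\<close>,
    \<open>e (e - 32) = 0\<close> and \<open>e (e - 27) = 0\<close>, which have no common solution;
    \<open>864 = (e - 32) (e - 27) - (32 / 5) e (e - 32) + (27 / 5) e (e - 27)\<close>.\<close>
  have "in_radical V x y (\<lambda>_. 864)"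
  proof (rule in_radical_root)
    show "in_radical V x y (\<lambda>p. a4 p * (a8 p * (32/15)) - a5 p * (a7 p * (17/12))
        - w p * (a11 p * (1/24)) - a3 p * (a9 p * (27/40)))"
      by (intro in_radical_diff in_radical_mult ra5 ra4 ra3 rw regular reg)
    show "864 ^ 1 = a4 p * (a8 p * (32/15)) - a5 p * (a7 p * (17/12))
        - w p * (a11 p * (1/24)) - a3 p * (a9 p * (27/40))" if "p \<in> V" for p
      using a11w[OF that] a4a8[OF that] a3a9[OF that] by algebra
  qed (rule regular)
  then obtain n where h: "in_ideal V x y (\<lambda>_. 864 ^ n)"
    unfolding in_radical_def by blast
  show ?thesis
    by (rule in_ideal_combination[OF h h regular_on_const[of V "1 / 864 ^ n"]
          regular_on_const[of V 0]]) simp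
qed

section \<open>The two families\<close>

lemma trivialising_sections:
  assumes reg: "regular_on V x" "regular_on V y" "regular_on V c" and "in_ideal V x y (\<lambda>_. 1)"
  shows "\<exists>s t. regular_on V s \<and> regular_on V t
    \<and> (\<forall>p\<in>V. x p ^ m * t p - y p ^ n * s p = c p)"
proof -
  have "in_ideal V (\<lambda>p. x p ^ m) (\<lambda>p. y p ^ n) (\<lambda>_. 1)"
    using unit_ideal_powers assms by blast
  then obtain \<alpha> \<beta> where ab: "regular_on V \<alpha>" "regular_on V \<beta>"
    "\<And>p. p \<in> V \<Longrightarrow> 1 = \<alpha> p * x p ^ m + \<beta> p * y p ^ n"
    unfolding in_ideal_def by blast
  show ?thesis
  proof (intro exI conjI ballI)
    show "regular_on V (\<lambda>p. - (c p * \<beta> p))" "regular_on V (\<lambda>p. c p * \<alpha> p)"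
      by (intro regular reg ab)+
    fix p assume "p \<in> V"
    have "x p ^ m * (c p * \<alpha> p) - y p ^ n * - (c p * \<beta> p)
        = c p * (\<alpha> p * x p ^ m + \<beta> p * y p ^ n)"
      by (simp add: algebra_simps)
    then show "x p ^ m * (c p * \<alpha> p) - y p ^ n * - (c p * \<beta> p) = c p"
      using ab(3)[OF \<open>p \<in> V\<close>] by simp
  qed
qed

lemma polynomial_fun_coord_power: "polynomial_fun (\<lambda>s. s $ i ^ k)"
  by (induction k) (auto intro: polynomial_fun.intros)

lemma additive_torsor_hypersurface_X:
  assumes "0 < m" "0 < n"
  shows "additive_torsor {s. s $ 1 \<noteq> 0 \<or> s $ 2 \<noteq> 0} (\<lambda>s. s $ 1 ^ m) (\<lambda>s. s $ 2 ^ n) (\<lambda>_. 1)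
    (hypersurface_X m n) (\<lambda>p. vector [p $ 1, p $ 2] :: complex ^ 2) (\<lambda>p. p $ 3) (\<lambda>p. p $ 4)
    (\<lambda>s \<mu> \<nu>. \<chi> i. if i = 1 then s $ 1 else if i = 2 then s $ 2 else if i = 3 then \<mu> else \<nu>)"
proof (standard, goal_cases)
  case (5 i)
  show ?case
    using exhaust_2[of i] by (auto intro: polynomial_fun.coord)
next
  case (7 p)
  then have "p $ 1 ^ m * p $ 4 - p $ 2 ^ n * p $ 3 = 1"
    by (simp add: hypersurface_X_def Let_def)
  then show ?case
    using assms by (auto simp: zero_power)
next
  case (14 j)
  show ?case
    using exhaust_4[of j] by auto
qed (auto simp: hypersurface_X_def Let_def vec_eq_iff forall_2 forall_4
      intro: polynomial_fun.coord polynomial_fun_coord_power)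

lemma exhaust_5: "i = 1 \<or> i = 2 \<or> i = 3 \<or> i = 4 \<or> i = 5" for i :: 5
proof (induct i)
  case (of_int z)
  then have "0 \<le> z" "z < 5" by simp_all
  then have "z = 0 \<or> z = 1 \<or> z = 2 \<or> z = 3 \<or> z = 4" by arith
  then show ?case by auto
qed

lemma forall_5: "(\<forall>i :: 5. P i) \<longleftrightarrow> P 1 \<and> P 2 \<and> P 3 \<and> P 4 \<and> P 5"
proof (intro iffI allI)
  show "P i" if "P 1 \<and> P 2 \<and> P 3 \<and> P 4 \<and> P 5" for i
    using that exhaust_5[of i] by auto
qed simp

lemma additive_torsor_bundle_E:
  assumes "0 < m" "0 < n"
  shows "additive_torsor punctured_U (\<lambda>s. s $ 1 ^ m) (\<lambda>s. s $ 2 ^ n) (\<lambda>s. s $ 3 ^ k)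
    (bundle_E m n k) base_proj (\<lambda>p. p $ 4) (\<lambda>p. p $ 5)
    (\<lambda>s \<mu> \<nu>. \<chi> i. if i = 1 then s $ 1 else if i = 2 then s $ 2 else if i = 3 then s $ 3
       else if i = 4 then \<mu> else \<nu>)"
proof (standard, goal_cases)
  case (5 i)
  show ?case
    unfolding base_proj_def using exhaust_3[of i] by (auto intro: polynomial_fun.coord)
next
  case (6 s)
  then show ?case
    by (auto simp: punctured_U_def surface_S_def Let_def vec_eq_iff forall_3)
next
  case (7 p)
  then show ?case
    by (simp add: bundle_E_def)
next
  case (8 p)
  show ?case
    by (simp add: base_proj_def vec_eq_iff forall_5)
next
  case (9 p)
  then show ?case
    by (simp add: bundle_E_def threefold_Z_def base_proj_def Let_def)
next
  case (10 s \<mu> \<nu>)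
  moreover have "base_proj (\<chi> i. if i = 1 then s $ 1 else if i = 2 then s $ 2
      else if i = 3 then s $ 3 else if i = 4 then \<mu> else \<nu>) = s"
    by (simp add: base_proj_def vec_eq_iff forall_3)
  ultimately show ?case
    by (simp add: bundle_E_def threefold_Z_def punctured_U_def surface_S_def Let_def)
next
  case (11 s \<mu> \<nu>)
  show ?case
    by (simp add: base_proj_def vec_eq_iff forall_3)
next
  case (14 j)
  show ?case
    using exhaust_5[of j] by auto
qed (rule polynomial_fun_coord_power polynomial_fun.coord | simp)+

lemma hypersurface_X_unit_ideal:
  assumes "0 < m" "0 < n"
  shows "in_ideal (hypersurface_X m n) (\<lambda>p. p $ 1) (\<lambda>p. p $ 2) (\<lambda>_. 1)"
  unfolding in_ideal_def
proof (intro exI conjI ballI)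
  show "regular_on (hypersurface_X m n) (\<lambda>p. p $ 1 ^ (m - 1) * p $ 4)"
    "regular_on (hypersurface_X m n) (\<lambda>p. - (p $ 2 ^ (n - 1) * p $ 3))"
    by (intro regular)+
  fix p assume "p \<in> hypersurface_X m n"
  then have "1 = p $ 1 ^ m * p $ 4 - p $ 2 ^ n * p $ 3"
    by (simp add: hypersurface_X_def Let_def)
  then show "1 = p $ 1 ^ (m - 1) * p $ 4 * p $ 1 + - (p $ 2 ^ (n - 1) * p $ 3) * p $ 2"
    using assms by (cases m; cases n) (simp_all add: algebra_simps)
qed

text \<open>
  Multiplication by \<open>x\<^sup>m\<^sup>-\<^sup>1 y\<^sup>n\<^sup>-\<^sup>1 z\<^sup>4\<^sup>-\<^sup>k\<close> takes the cocycle of \<open>E\<^sub>m\<^sub>,\<^sub>n\<^sub>,\<^sub>k\<close> to \<open>z\<^sup>4 / (x y)\<close>, and so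
  maps the torsor to the icosahedral one.
\<close>

lemma bundle_E_unit_ideal:
  assumes "0 < m" "0 < n" "k \<le> 4"
  shows "in_ideal (bundle_E m n k) (\<lambda>p. p $ 1) (\<lambda>p. p $ 2) (\<lambda>_. 1)"
proof (rule icosahedral_unit_ideal)
  show "regular_on (bundle_E m n k) (\<lambda>p. p $ 3)"
    "regular_on (bundle_E m n k) (\<lambda>p. p $ 3 ^ (4 - k) * p $ 2 ^ (n - 1) * p $ 4)"
    "regular_on (bundle_E m n k) (\<lambda>p. p $ 3 ^ (4 - k) * p $ 1 ^ (m - 1) * p $ 5)"
    "regular_on (bundle_E m n k) (\<lambda>p. p $ 1)" "regular_on (bundle_E m n k) (\<lambda>p. p $ 2)"
    by (intro regular)+
  fix p assume p: "p \<in> bundle_E m n k"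
  then show S: "p $ 1 ^ 2 + p $ 2 ^ 3 + p $ 3 ^ 5 = 0"
    by (simp add: bundle_E_def threefold_Z_def Let_def)
  show "p $ 1 \<noteq> 0 \<or> p $ 2 \<noteq> 0"
    using p S by (auto simp: bundle_E_def punctured_U_def base_proj_def vec_eq_iff forall_3)
  have "p $ 1 ^ m * p $ 5 - p $ 2 ^ n * p $ 4 = p $ 3 ^ k"
    using p by (simp add: bundle_E_def threefold_Z_def Let_def)
  moreover have "p $ 1 * p $ 1 ^ (m - 1) = p $ 1 ^ m" "p $ 2 * p $ 2 ^ (n - 1) = p $ 2 ^ n"
    using assms by (simp_all add: power_eq_if)
  moreover have "p $ 3 ^ (4 - k) * p $ 3 ^ k = p $ 3 ^ 4"
    using assms(3) by (simp flip: power_add)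
  moreover have "p $ 1 * (p $ 3 ^ (4 - k) * p $ 1 ^ (m - 1) * p $ 5)
      - p $ 2 * (p $ 3 ^ (4 - k) * p $ 2 ^ (n - 1) * p $ 4)
      = p $ 3 ^ (4 - k) * (p $ 1 * p $ 1 ^ (m - 1) * p $ 5 - p $ 2 * p $ 2 ^ (n - 1) * p $ 4)"
    by (simp add: algebra_simps)
  ultimately show "p $ 1 * (p $ 3 ^ (4 - k) * p $ 1 ^ (m - 1) * p $ 5)
      - p $ 2 * (p $ 3 ^ (4 - k) * p $ 2 ^ (n - 1) * p $ 4) = p $ 3 ^ 4"
    by simp
qed

theorem mainTheorem5:
  "(\<forall>m n p q :: nat. 0 < m \<and> 0 < n \<and> 0 < p \<and> 0 < q \<longrightarrow>
      hypersurface_X m n \<times>\<^sub>v affine_line \<cong>\<^sub>v hypersurface_X p q \<times>\<^sub>v affine_line)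
   \<and> (\<forall>m n p q k l :: nat. 0 < m \<and> 0 < n \<and> 0 < p \<and> 0 < q \<and> k \<le> 4 \<and> l \<le> 4 \<longrightarrow>
      bundle_E m n k \<times>\<^sub>v affine_line \<cong>\<^sub>v bundle_E p q l \<times>\<^sub>v affine_line)"
proof (intro conjI allI impI; elim conjE)
  fix m n p q :: nat
  assume pos: "0 < m" "0 < n" "0 < p" "0 < q"
  note sections = trivialising_sections[OF regular_on_coord regular_on_coord regular_on_const
      hypersurface_X_unit_ideal]
  obtain s t where st: "regular_on (hypersurface_X m n) s" "regular_on (hypersurface_X m n) t"
    "\<forall>x\<in>hypersurface_X m n. x $ 1 ^ p * t x - x $ 2 ^ q * s x = 1"
    using sections[OF pos(1,2), of p q 1] by blast
  obtain s' t' where st': "regular_on (hypersurface_X p q) s'" "regular_on (hypersurface_X p q) t'"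
    "\<forall>x\<in>hypersurface_X p q. x $ 1 ^ m * t' x - x $ 2 ^ n * s' x = 1"
    using sections[OF pos(3,4), of m n 1] by blast
  show "hypersurface_X m n \<times>\<^sub>v affine_line \<cong>\<^sub>v hypersurface_X p q \<times>\<^sub>v affine_line"
    by (rule additive_torsor_times_line_isomorphic[OF
          additive_torsor_hypersurface_X[OF pos(1,2)] additive_torsor_hypersurface_X[OF pos(3,4)]
          st(1,2) _ st'(1,2)]) (use st(3) st'(3) in simp_all)
next
  fix m n p q k l :: nat
  assume pos: "0 < m" "0 < n" "0 < p" "0 < q" and kl: "k \<le> 4" "l \<le> 4"
  note sections = trivialising_sections[OF regular_on_coord regular_on_coord
      regular_on_power[OF regular_on_coord] bundle_E_unit_ideal]
  obtain s t where st: "regular_on (bundle_E m n k) s" "regular_on (bundle_E m n k) t"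
    "\<forall>x\<in>bundle_E m n k. x $ 1 ^ p * t x - x $ 2 ^ q * s x = x $ 3 ^ l"
    using sections[OF pos(1,2) kl(1), of p q 3 l] by blast
  obtain s' t' where st': "regular_on (bundle_E p q l) s'" "regular_on (bundle_E p q l) t'"
    "\<forall>x\<in>bundle_E p q l. x $ 1 ^ m * t' x - x $ 2 ^ n * s' x = x $ 3 ^ k"
    using sections[OF pos(3,4) kl(2), of m n 3 k] by blast
  show "bundle_E m n k \<times>\<^sub>v affine_line \<cong>\<^sub>v bundle_E p q l \<times>\<^sub>v affine_line"
    by (rule additive_torsor_times_line_isomorphic[OF
          additive_torsor_bundle_E[OF pos(1,2)] additive_torsor_bundle_E[OF pos(3,4)]
          st(1,2) _ st'(1,2)]) (use st(3) st'(3) in \<open>simp_all add: base_proj_def\<close>)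
qed

end
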